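(* For a bounded geometry quasi-geodesic coarse median space $(X,d,\mu)$, the metric $d$ is quasi-isometric to the induced metric $d_\mu$; that is, there are constants $L,C>0$ with $L^{-1}d(a,b)-C\le d_\mu(a,b)\le L\,d(a,b)+C$ for all $a,b\in X$.
   Context: Coarse median space: a triple $(X,d,\mu)$ with $(X,d)$ a metric space and $\mu:X^3\to X$ satisfying: (M1) $\mu(a,a,b)=a$; (M2) $\mu$ is invariant under all permutations of its three arguments; (C1) there is an affine function $\rho:[0,\infty)\to[0,\infty)$ with $d(\mu(a,b,c),\mu(a',b,c))\le\rho(d(a,a'))$ for all $a,a',b,c\in X$; (C2) there is a constant $\kappa_4>0$ with $d(\mu(\mu(a,b,c),b,d),\mu(a,b,\mu(c,b,d)))\le\kappa_4$ for all $a,b,c,d\in X$. Bounded geometry: for every $r>0$ there is $n\in\mathbb N$ such that every ball $B(x,r)$ has at most $n$ points. Quasi-geodesic: there are constants $L,C>0$ such that for any $x,y\in X$ there is a map $\gamma:[0,d(x,y)]\to X$ with $\gamma(0)=x$, $\gamma(d(x,y))=y$ and $L^{-1}|s-t|-C\le d(\gamma(s),\gamma(t))\le L|s-t|+C$ for all $s,t$. Intervals: $[a,b]=\{\mu(a,x,b)\mid x\in X\}$; these are finite for a coarse median space of bounded geometry. Induced metric: $d_\mu(a,b)=\min\{\sum_{i=1}^n(\sharp[x_{i-1},x_i]-1): a=x_0,\ldots,x_n=b,\ x_i\in X,\ n\in\mathbb N\}$, where $\sharp$ denotes cardinality. It is a metric because (M1) and (M2) hold and intervals are finite. *)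

theory Defs
  imports "HOL-Analysis.Analysis"
begin

locale coarse_median_space = Metric_space M d
  for M :: "'a set" and d :: "'a \<Rightarrow> 'a \<Rightarrow> real" +
  fixes \<mu> :: "'a \<Rightarrow> 'a \<Rightarrow> 'a \<Rightarrow> 'a"
  assumes median_closed: "\<lbrakk>a \<in> M; b \<in> M; c \<in> M\<rbrakk> \<Longrightarrow> \<mu> a b c \<in> M"
    and M1: "\<lbrakk>a \<in> M; b \<in> M\<rbrakk> \<Longrightarrow> \<mu> a a b = a"
    and M2: "\<lbrakk>a \<in> M; b \<in> M; c \<in> M\<rbrakk> \<Longrightarrow>
      \<mu> a c b = \<mu> a b c \<and> \<mu> b a c = \<mu> a b c \<and> \<mu> b c a = \<mu> a b c \<and>
      \<mu> c a b = \<mu> a b c \<and> \<mu> c b a = \<mu> a b c"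
    and C1: "\<exists>\<rho> :: real \<Rightarrow> real.
      (\<exists>K H. \<forall>t\<ge>0. \<rho> t = K * t + H) \<and> (\<forall>t\<ge>0. \<rho> t \<ge> 0) \<and>
      (\<forall>a\<in>M. \<forall>a'\<in>M. \<forall>b\<in>M. \<forall>c\<in>M. d (\<mu> a b c) (\<mu> a' b c) \<le> \<rho> (d a a'))"
    and C2: "\<exists>\<kappa>\<^sub>4>0. \<forall>a\<in>M. \<forall>b\<in>M. \<forall>c\<in>M. \<forall>e\<in>M.
      d (\<mu> (\<mu> a b c) b e) (\<mu> a b (\<mu> c b e)) \<le> \<kappa>\<^sub>4"

definition (in Metric_space) bounded_geometry :: bool where
  "bounded_geometry \<longleftrightarrow>
    (\<forall>r>0. \<exists>n. \<forall>x\<in>M. finite (mball x r) \<and> card (mball x r) \<le> n)"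

definition (in Metric_space) quasi_geodesic :: bool where
  "quasi_geodesic \<longleftrightarrow>
    (\<exists>L>0. \<exists>C>0. \<forall>x\<in>M. \<forall>y\<in>M. \<exists>\<gamma> \<in> {0..d x y} \<rightarrow> M.
      \<gamma> 0 = x \<and> \<gamma> (d x y) = y \<and>
      (\<forall>s\<in>{0..d x y}. \<forall>t\<in>{0..d x y}.
        inverse L * \<bar>s - t\<bar> - C \<le> d (\<gamma> s) (\<gamma> t) \<and>
        d (\<gamma> s) (\<gamma> t) \<le> L * \<bar>s - t\<bar> + C))"

definition median_interval :: "'a set \<Rightarrow> ('a \<Rightarrow> 'a \<Rightarrow> 'a \<Rightarrow> 'a) \<Rightarrow> 'a \<Rightarrow> 'a \<Rightarrow> 'a set" where
  "median_interval M \<mu> a b = {\<mu> a x b | x. x \<in> M}"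

text \<open>
  The minimum ranges over natural numbers, hence is attained. The value is meaningful only
  when all intervals are finite, because \<open>card\<close> is \<open>0\<close> on infinite sets and
  subtraction is truncated; with bounded geometry every interval is finite and
  contains at least one point (see below), so no truncation occurs.
\<close>

definition induced_metric :: "'a set \<Rightarrow> ('a \<Rightarrow> 'a \<Rightarrow> 'a \<Rightarrow> 'a) \<Rightarrow> 'a \<Rightarrow> 'a \<Rightarrow> nat" where
  "induced_metric M \<mu> a b =
    (LEAST s. \<exists>(n::nat) x. x 0 = a \<and> x n = b \<and> (\<forall>i\<le>n. x i \<in> M) \<and>
      s = (\<Sum>i=1..n. (card (median_interval M \<mu> (x (i - 1)) (x i)) - 1)))"

context coarse_median_space
begin

lemma interval_contains:
  assumes "a \<in> M" "b \<in> M"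
  shows "a \<in> median_interval M \<mu> a b" "b \<in> median_interval M \<mu> a b"
proof -
  have "\<mu> a a b = a" "\<mu> a b b = b"
    using assms M1[of a b] M1[of b a] M2[of b b a] by auto
  then show "a \<in> median_interval M \<mu> a b" "b \<in> median_interval M \<mu> a b"
    unfolding median_interval_def using assms by (metis (mono_tags, lifting) mem_Collect_eq)+
qed

lemma interval_self:
  assumes "a \<in> M"
  shows "median_interval M \<mu> a a = {a}"
proof -
  have "\<mu> a x a = a" if "x \<in> M" for x
    using assms that M1[of a x] M2[of a a x] by auto
  with assms show ?thesis
    using interval_contains[of a a] unfolding median_interval_def by blast
qed

lemma interval_commute:
  "a \<in> M \<Longrightarrow> b \<in> M \<Longrightarrow> median_interval M \<mu> a b = median_interval M \<mu> b a"
  unfolding median_interval_def by (metis (no_types, lifting) M2)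

lemma finite_interval:
  assumes "bounded_geometry" and ab: "a \<in> M" "b \<in> M"
  shows "finite (median_interval M \<mu> a b)"
proof -
  obtain \<rho> where \<rho>: "\<forall>t\<ge>0. \<rho> t \<ge> (0::real)"
    "\<forall>a\<in>M. \<forall>a'\<in>M. \<forall>b\<in>M. \<forall>c\<in>M. d (\<mu> a b c) (\<mu> a' b c) \<le> \<rho> (d a a')"
    using C1 by auto
  let ?r = "\<rho> (d a b) + 1"
  have "median_interval M \<mu> a b \<subseteq> mball a ?r"
  proof
    fix y assume "y \<in> median_interval M \<mu> a b"
    then obtain x where x: "x \<in> M" "y = \<mu> a x b"
      unfolding median_interval_def by auto
    have "\<mu> a a x = a" "\<mu> b a x = y"
      using x ab M1[of a x] M2[of a x b] by auto
    then have "d a y \<le> \<rho> (d a b)"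
      using \<rho>(2) ab x by metis
    then show "y \<in> mball a ?r"
      using x ab median_closed by auto
  qed
  moreover have "?r > 0" using \<rho>(1)[rule_format, of "d a b"] by simp
  ultimately show ?thesis
    using assms unfolding bounded_geometry_def by (meson finite_subset)
qed

lemma card_interval_pos:
  "bounded_geometry \<Longrightarrow> a \<in> M \<Longrightarrow> b \<in> M \<Longrightarrow> card (median_interval M \<mu> a b) \<ge> 1"
  using finite_interval interval_contains by (metis One_nat_def Suc_leI card_gt_0_iff empty_iff)

lemma induced_metric_le:
  fixes n :: nat
  assumes "\<forall>i\<le>n. x i \<in> M"
  shows "induced_metric M \<mu> (x 0) (x n) \<le>
    (\<Sum>i=1..n. (card (median_interval M \<mu> (x (i - 1)) (x i)) - 1))"
  unfolding induced_metric_def by (rule Least_le) (use assms in blast)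

lemma induced_metric_attained:
  assumes "a \<in> M" "b \<in> M"
  obtains x and n :: nat where "x 0 = a" "x n = b" "\<forall>i\<le>n. x i \<in> M"
    "induced_metric M \<mu> a b = (\<Sum>i=1..n. (card (median_interval M \<mu> (x (i - 1)) (x i)) - 1))"
proof -
  let ?P = "\<lambda>s. \<exists>(n::nat) x. x 0 = a \<and> x n = b \<and> (\<forall>i\<le>n. x i \<in> M) \<and>
      s = (\<Sum>i=1..n. (card (median_interval M \<mu> (x (i - 1)) (x i)) - 1))"
  have "?P (\<Sum>i=1..1. (card (median_interval M \<mu> ((\<lambda>i::nat. if i = 0 then a else b) (i - 1))
      ((\<lambda>i. if i = 0 then a else b) i)) - 1))"
    by (rule exI[of _ "1::nat"], rule exI[of _ "\<lambda>i::nat. if i = 0 then a else b"]) (use assms in auto)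
  then have "?P (induced_metric M \<mu> a b)"
    unfolding induced_metric_def by (rule LeastI[of ?P])
  then show ?thesis using that by blast
qed

lemma induced_metric_eq_0_iff:
  assumes bg: "bounded_geometry" and ab: "a \<in> M" "b \<in> M"
  shows "induced_metric M \<mu> a b = 0 \<longleftrightarrow> a = b"
proof
  assume 0: "induced_metric M \<mu> a b = 0"
  obtain x and n :: nat where x: "x 0 = a" "x n = b" "\<forall>i\<le>n. x i \<in> M"
    "induced_metric M \<mu> a b = (\<Sum>i=1..n. (card (median_interval M \<mu> (x (i - 1)) (x i)) - 1))"
    by (rule induced_metric_attained[OF ab])
  have step: "x (i - 1) = x i" if "i \<in> {1..n}" for i
  proof -
    have M: "x (i - 1) \<in> M" "x i \<in> M" using that x(3) by auto
    have "card (median_interval M \<mu> (x (i - 1)) (x i)) - 1 = 0"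
      using 0[unfolded x(4)] that by (simp only: sum_eq_0_iff finite_atLeastAtMost)
    then have "card (median_interval M \<mu> (x (i - 1)) (x i)) \<le> Suc 0"
      by linarith
    then show ?thesis
      using interval_contains[OF M] card_le_Suc0_iff_eq[OF finite_interval[OF bg M]] by blast
  qed
  have "x i = a" if "i \<le> n" for i
    using that
  proof (induction i)
    case (Suc i)
    then show ?case using step[of "Suc i"] by simp
  qed (simp add: x)
  then show "a = b" using x(2) by auto
next
  assume "a = b"
  then show "induced_metric M \<mu> a b = 0"
    using induced_metric_le[of 0 "\<lambda>_. a"] ab by simp
qed

lemma induced_metric_triangle:
  assumes abc: "a \<in> M" "b \<in> M" "c \<in> M"
  shows "induced_metric M \<mu> a c \<le> induced_metric M \<mu> a b + induced_metric M \<mu> b c"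
proof -
  let ?f = "\<lambda>x y. card (median_interval M \<mu> x y) - 1"
  obtain x and n :: nat where x: "x 0 = a" "x n = b" "\<forall>i\<le>n. x i \<in> M"
    "induced_metric M \<mu> a b = (\<Sum>i=1..n. ?f (x (i - 1)) (x i))"
    by (rule induced_metric_attained[OF abc(1,2)])
  obtain y and m :: nat where y: "y 0 = b" "y m = c" "\<forall>i\<le>m. y i \<in> M"
    "induced_metric M \<mu> b c = (\<Sum>i=1..m. ?f (y (i - 1)) (y i))"
    by (rule induced_metric_attained[OF abc(2,3)])
  define z where "z = (\<lambda>i. if i \<le> n then x i else y (i - n))"
  have z: "z 0 = a" "z (n + m) = c" "\<forall>i\<le>n+m. z i \<in> M"
    using x(1-3) y(1-3) by (auto simp: z_def)
  have "(\<Sum>i=1..n+m. ?f (z (i - 1)) (z i)) =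
      (\<Sum>i=1..n. ?f (z (i - 1)) (z i)) + (\<Sum>i=n+1..n+m. ?f (z (i - 1)) (z i))"
    by (rule sum.ub_add_nat) simp
  also have "(\<Sum>i=1..n. ?f (z (i - 1)) (z i)) = induced_metric M \<mu> a b"
    unfolding x(4) by (rule sum.cong) (auto simp: z_def)
  also have "(\<Sum>i=n+1..n+m. ?f (z (i - 1)) (z i)) = (\<Sum>i=1..m. ?f (z (i + n - 1)) (z (i + n)))"
    using sum.shift_bounds_cl_nat_ivl[of "\<lambda>i. ?f (z (i - 1)) (z i)" 1 n m] by (simp add: add.commute)
  also have "\<dots> = induced_metric M \<mu> b c"
    unfolding y(4)
  proof (rule sum.cong)
    fix i assume "i \<in> {1..m}"
    moreover have "z (i + n - 1) = y (i - 1)"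
      using x(2) y(1) \<open>i \<in> {1..m}\<close> by (cases "i = 1") (auto simp: z_def)
    ultimately show "?f (z (i + n - 1)) (z (i + n)) = ?f (y (i - 1)) (y i)"
      by (auto simp: z_def)
  qed simp
  finally show ?thesis
    using induced_metric_le[OF z(3)] z(1,2) by simp
qed

lemma induced_metric_commute_le:
  assumes ab: "a \<in> M" "b \<in> M"
  shows "induced_metric M \<mu> b a \<le> induced_metric M \<mu> a b"
proof -
  let ?f = "\<lambda>x y. card (median_interval M \<mu> x y) - 1"
  obtain x and n :: nat where x: "x 0 = a" "x n = b" "\<forall>i\<le>n. x i \<in> M"
    "induced_metric M \<mu> a b = (\<Sum>i=1..n. ?f (x (i - 1)) (x i))"
    by (rule induced_metric_attained[OF ab])
  define z where "z = (\<lambda>i. x (n - i))"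
  have "(\<Sum>i=1..n. ?f (z (i - 1)) (z i)) = (\<Sum>i=1..n. ?f (x (i - 1)) (x i))"
  proof (rule sum.reindex_bij_witness[of _ "\<lambda>i. n + 1 - i" "\<lambda>i. n + 1 - i"])
    fix i assume i: "i \<in> {1..n}"
    have eq: "n - (i - 1) - 1 = n - i" "n + 1 - i = n - (i - 1)" using i by auto
    have "x (n - i) \<in> M" "x (n - (i - 1)) \<in> M" using x(3) by auto
    from interval_commute[OF this]
    show "?f (x (n + 1 - i - 1)) (x (n + 1 - i)) = ?f (z (i - 1)) (z i)"
      unfolding z_def eq(2) eq(1) by (rule arg_cong)
  qed auto
  moreover have "\<forall>i\<le>n. z i \<in> M" "z 0 = b" "z n = a"
    using x by (auto simp: z_def)
  ultimately show ?thesis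
    using induced_metric_le[of n z] x(4) by simp
qed

lemma Metric_space_induced_metric:
  assumes "bounded_geometry"
  shows "Metric_space M
    (\<lambda>a b. if a \<in> M \<and> b \<in> M then real (induced_metric M \<mu> a b) else 0)"
proof
  fix a b c
  show "(if a \<in> M \<and> b \<in> M then real (induced_metric M \<mu> a b) else 0) =
      (if b \<in> M \<and> a \<in> M then real (induced_metric M \<mu> b a) else 0)"
    using induced_metric_commute_le[of a b] induced_metric_commute_le[of b a] by auto
  assume "a \<in> M" "b \<in> M"
  then show "((if a \<in> M \<and> b \<in> M then real (induced_metric M \<mu> a b) else 0) = 0) = (a = b)"
    using induced_metric_eq_0_iff[OF assms] by simp
  assume "c \<in> M"
  then show "(if a \<in> M \<and> c \<in> M then real (induced_metric M \<mu> a c) else 0) \<le>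
      (if a \<in> M \<and> b \<in> M then real (induced_metric M \<mu> a b) else 0) +
      (if b \<in> M \<and> c \<in> M then real (induced_metric M \<mu> b c) else 0)"
    using induced_metric_triangle[of a b c] \<open>a \<in> M\<close> \<open>b \<in> M\<close> by simp
qed simp

end

end

theory Submission
  imports Defs
begin

text \<open>
  Quasi-geodesics are used only through their sampling at integer times: any two points are
  joined by a discrete path with steps of bounded size, whose number of steps is at most
  the distance plus one (\<open>quasi_geodesic_discrete_path\<close>).

  For the upper bound on the induced metric, each step of such a path has bounded
  length, so its endpoints span an interval contained in a ball of bounded radius, and
  bounded geometry bounds the number of points in it (\<open>card_interval_bounded\<close>). Hence each
  step contributes a bounded amount to the induced length of the path.

  For the lower bound, the coarsely Lipschitz map \<open>x \<mapsto> \<mu> a x b\<close> carries a discrete path from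
  \<open>a\<close> to \<open>b\<close> into the interval \<open>[a, b]\<close> and fixes its endpoints. The interval therefore contains
  a path from \<open>a\<close> to \<open>b\<close> with steps of size at most some uniform \<open>R\<close>. After deletion of its loops
  such a path has fewer steps than the interval has points (\<open>dist_le_step_times_card\<close>), so
  \<open>d a b \<le> R * (card [a, b] - 1)\<close>. Summing this along a chain that realises the induced metric
  gives \<open>d a b \<le> R * d\<^sub>\<mu> a b\<close>.
\<close>

section \<open>Discrete paths in metric spaces\<close>

context Metric_space
begin

text \<open>Only the last visit to the starting point matters: what follows it is a path in the
  remaining points, so the claim follows by induction on the size of the set.\<close>

lemma dist_le_step_times_card:
  fixes n :: nat
  assumes "finite S" "S \<subseteq> M" "\<forall>i\<le>n. z i \<in> S"
    and step: "\<forall>i<n. d (z i) (z (Suc i)) \<le> R" and "R \<ge> 0"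
  shows "d (z 0) (z n) \<le> R * real (card S - 1)"
  using assms(1-4)
proof (induction "card S" arbitrary: S z n rule: less_induct)
  case less
  define k where "k = Max {i. i \<le> n \<and> z i = z 0}"
  have "k \<in> {i. i \<le> n \<and> z i = z 0}"
    unfolding k_def by (rule Max_in) auto
  then have k: "k \<le> n" "z k = z 0" by auto
  have last_visit: "z i \<noteq> z 0" if "k < i" "i \<le> n" for i
  proof
    assume "z i = z 0"
    with that have "i \<le> k" unfolding k_def by (intro Max_ge) auto
    with that show False by simp
  qed
  have z0: "z 0 \<in> S" "z 0 \<in> M" using less.prems by auto
  show ?case
  proof (cases "k = n")
    case True
    then show ?thesis using k z0 \<open>R \<ge> 0\<close> by simp
  next
    case False
    with k have "k < n" by simp
    let ?S = "S - {z 0}"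
    have tail: "z i \<in> ?S" if "k < i" "i \<le> n" for i
      using last_visit that less.prems(3) by simp
    have card: "card S = Suc (card ?S)"
      using card.remove[OF less.prems(1) z0(1)] .
    have "card ?S \<noteq> 0"
      using tail[of "Suc k"] \<open>k < n\<close> less.prems(1) by auto
    have in_M: "z (Suc k) \<in> M" "z n \<in> M"
      using tail \<open>k < n\<close> less.prems(2) by auto
    have "d (z (Suc k + 0)) (z (Suc k + (n - Suc k))) \<le> R * real (card ?S - 1)"
      by (rule less.hyps[of ?S _ "\<lambda>i. z (Suc k + i)"]) (use card tail less.prems \<open>k < n\<close> in auto)
    moreover have "d (z 0) (z (Suc k)) \<le> R"
      using less.prems(4)[rule_format, OF \<open>k < n\<close>] k(2) by simp
    moreover have "d (z 0) (z n) \<le> d (z 0) (z (Suc k)) + d (z (Suc k)) (z n)"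
      using triangle z0 in_M by blast
    moreover have "real (card S - 1) = 1 + real (card ?S - 1)"
      using card \<open>card ?S \<noteq> 0\<close> by simp
    ultimately show ?thesis
      using \<open>k < n\<close> by (simp add: distrib_left)
  qed
qed

lemma dist_le_sum_steps:
  fixes n :: nat
  assumes "\<forall>i\<le>n. x i \<in> M"
  shows "d (x 0) (x n) \<le> (\<Sum>i=1..n. d (x (i - 1)) (x i))"
  using assms
proof (induction n)
  case (Suc n)
  then have "d (x 0) (x (Suc n)) \<le> d (x 0) (x n) + d (x n) (x (Suc n))"
    using triangle by simp
  with Suc show ?case by simp
qed simp

text \<open>The quasi-geodesic is evaluated at the integers below the distance and at its right
  end; consecutive times then differ by at most one.\<close>

lemma quasi_geodesic_discrete_path:
  assumes quasi_geodesic
  shows "\<exists>r>0. \<forall>a\<in>M. \<forall>b\<in>M. \<exists>(n::nat) z. z 0 = a \<and> z n = b \<and> (\<forall>i\<le>n. z i \<in> M) \<and>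
    (\<forall>i<n. d (z i) (z (Suc i)) \<le> r) \<and> real n \<le> d a b + 1"
proof -
  obtain L C where LC: "L > 0" "C > 0" and
    geo: "\<forall>x\<in>M. \<forall>y\<in>M. \<exists>\<gamma> \<in> {0..d x y} \<rightarrow> M.
      \<gamma> 0 = x \<and> \<gamma> (d x y) = y \<and>
      (\<forall>s\<in>{0..d x y}. \<forall>t\<in>{0..d x y}.
        inverse L * \<bar>s - t\<bar> - C \<le> d (\<gamma> s) (\<gamma> t) \<and> d (\<gamma> s) (\<gamma> t) \<le> L * \<bar>s - t\<bar> + C)"
    using assms unfolding quasi_geodesic_def by blast
  show ?thesis
  proof (intro exI[of _ "L + C"] conjI ballI)
    show "L + C > 0" using LC by simp
  next
    fix a b assume ab: "a \<in> M" "b \<in> M"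
    then obtain \<gamma> where \<gamma>: "\<gamma> \<in> {0..d a b} \<rightarrow> M" "\<gamma> 0 = a" "\<gamma> (d a b) = b" and
      lip: "\<And>s t. \<lbrakk>s \<in> {0..d a b}; t \<in> {0..d a b}\<rbrakk> \<Longrightarrow> d (\<gamma> s) (\<gamma> t) \<le> L * \<bar>s - t\<bar> + C"
      using geo by blast
    define n where "n = nat \<lceil>d a b\<rceil>"
    define t where "t = (\<lambda>i::nat. min (real i) (d a b))"
    have t_mem: "t i \<in> {0..d a b}" for i by (simp add: t_def)
    have n: "d a b \<le> real n" "real n \<le> d a b + 1"
      unfolding n_def using nonneg[of a b] by linarith+
    have "\<gamma> (t 0) = a" "\<gamma> (t n) = b" using \<gamma> n by (simp_all add: t_def min_def)
    moreover have "\<gamma> (t i) \<in> M" for i using \<gamma>(1) t_mem[of i] by blast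
    moreover have "d (\<gamma> (t i)) (\<gamma> (t (Suc i))) \<le> L + C" for i
    proof -
      have "\<bar>t i - t (Suc i)\<bar> \<le> 1" by (simp add: t_def min_def)
      then have "L * \<bar>t i - t (Suc i)\<bar> \<le> L * 1" using LC by (intro mult_left_mono) auto
      then show ?thesis using lip[OF t_mem t_mem, of i "Suc i"] by simp
    qed
    ultimately show "\<exists>(n::nat) z. z 0 = a \<and> z n = b \<and> (\<forall>i\<le>n. z i \<in> M) \<and>
        (\<forall>i<n. d (z i) (z (Suc i)) \<le> L + C) \<and> real n \<le> d a b + 1"
      using n(2) by (intro exI[of _ n] exI[of _ "\<lambda>i. \<gamma> (t i)"]) simp
  qed
qed

end

section \<open>Intervals and the induced metric\<close>

context coarse_median_space
begin

text \<open>By symmetry the affine control of the median in its first argument holds in the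
  second. Passing to absolute values makes the control nondecreasing in the distance.\<close>

lemma median_coarsely_lipschitz:
  "\<exists>K\<ge>0. \<exists>H\<ge>0. \<forall>a\<in>M. \<forall>b\<in>M. \<forall>x\<in>M. \<forall>y\<in>M. d (\<mu> a x b) (\<mu> a y b) \<le> K * d x y + H"
proof -
  obtain \<rho> K H where \<rho>: "\<forall>t\<ge>0. \<rho> t = K * t + H"
    "\<forall>a\<in>M. \<forall>a'\<in>M. \<forall>b\<in>M. \<forall>c\<in>M. d (\<mu> a b c) (\<mu> a' b c) \<le> \<rho> (d a a')"
    using C1 by blast
  have first: "d (\<mu> x a b) (\<mu> y a b) \<le> \<bar>K\<bar> * d x y + \<bar>H\<bar>"
    if "a \<in> M" "b \<in> M" "x \<in> M" "y \<in> M" for a b x y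
  proof -
    have "d (\<mu> x a b) (\<mu> y a b) \<le> K * d x y + H"
      using \<rho> that nonneg[of x y] by auto
    also have "\<dots> \<le> \<bar>K\<bar> * d x y + \<bar>H\<bar>"
      by (intro add_mono mult_right_mono) auto
    finally show ?thesis .
  qed
  show ?thesis
  proof (rule exI[of _ "\<bar>K\<bar>"], rule conjI, rule abs_ge_zero,
      rule exI[of _ "\<bar>H\<bar>"], intro conjI ballI)
    fix a b x y assume in_M: "a \<in> M" "b \<in> M" "x \<in> M" "y \<in> M"
    then have "\<mu> a x b = \<mu> x a b" "\<mu> a y b = \<mu> y a b"
      using M2[of x a b] M2[of y a b] by simp_all
    then show "d (\<mu> a x b) (\<mu> a y b) \<le> \<bar>K\<bar> * d x y + \<bar>H\<bar>"
      using first[OF in_M] by simp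
  qed simp_all
qed

text \<open>The point \<open>\<mu> a x b = \<mu> x b a\<close> of the interval is compared with \<open>\<mu> x a a = a\<close>: as \<open>b\<close> is at
  distance at most \<open>r\<close> from \<open>a\<close>, the coarse Lipschitz property places the whole interval in a
  ball about \<open>a\<close> whose radius depends on \<open>r\<close> only.\<close>

lemma card_interval_bounded:
  assumes bounded_geometry "r \<ge> 0"
  shows "\<exists>N. \<forall>a\<in>M. \<forall>b\<in>M. d a b \<le> r \<longrightarrow> card (median_interval M \<mu> a b) \<le> N"
proof -
  obtain K H where KH: "K \<ge> 0" "H \<ge> 0" and
    lip: "\<forall>a\<in>M. \<forall>b\<in>M. \<forall>x\<in>M. \<forall>y\<in>M. d (\<mu> a x b) (\<mu> a y b) \<le> K * d x y + H"
    using median_coarsely_lipschitz by blast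
  define q where "q = K * r + H + 1"
  have "q > 0" using KH \<open>r \<ge> 0\<close> by (simp add: q_def add_nonneg_pos)
  then obtain N where N: "\<forall>x\<in>M. finite (mball x q) \<and> card (mball x q) \<le> N"
    using assms(1) unfolding bounded_geometry_def by blast
  show ?thesis
  proof (intro exI[of _ N] ballI impI)
    fix a b assume ab: "a \<in> M" "b \<in> M" "d a b \<le> r"
    have "median_interval M \<mu> a b \<subseteq> mball a q"
    proof
      fix y assume "y \<in> median_interval M \<mu> a b"
      then obtain x where x: "x \<in> M" "y = \<mu> a x b"
        unfolding median_interval_def by auto
      have "\<mu> x a a = a" "\<mu> x b a = y" using ab x M1[of a x] M2[of a a x] M2[of a x b] by auto
      then have "d a y \<le> K * d a b + H" using lip[rule_format, of x a a b] ab x by simp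
      also have "\<dots> \<le> K * r + H" using ab KH by (simp add: mult_left_mono)
      finally show "y \<in> mball a q" using ab x median_closed by (simp add: q_def)
    qed
    then have "card (median_interval M \<mu> a b) \<le> card (mball a q)"
      using N ab by (simp add: card_mono)
    also have "\<dots> \<le> N" using N ab by blast
    finally show "card (median_interval M \<mu> a b) \<le> N" .
  qed
qed

text \<open>The points \<open>\<mu> a (z i) b\<close>, for a discrete path \<open>z\<close> from \<open>a\<close> to \<open>b\<close>, form a path inside the
  interval, and its steps are bounded uniformly in \<open>a\<close> and \<open>b\<close>.\<close>

lemma dist_le_card_interval:
  assumes bounded_geometry quasi_geodesic
  shows "\<exists>R\<ge>0. \<forall>a\<in>M. \<forall>b\<in>M. d a b \<le> R * real (card (median_interval M \<mu> a b) - 1)"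
proof -
  obtain K H where KH: "K \<ge> 0" "H \<ge> 0" and
    lip: "\<forall>a\<in>M. \<forall>b\<in>M. \<forall>x\<in>M. \<forall>y\<in>M. d (\<mu> a x b) (\<mu> a y b) \<le> K * d x y + H"
    using median_coarsely_lipschitz by blast
  obtain r where "r > 0" and
    path: "\<forall>a\<in>M. \<forall>b\<in>M. \<exists>(n::nat) z. z 0 = a \<and> z n = b \<and> (\<forall>i\<le>n. z i \<in> M) \<and>
      (\<forall>i<n. d (z i) (z (Suc i)) \<le> r) \<and> real n \<le> d a b + 1"
    using quasi_geodesic_discrete_path[OF assms(2)] by blast
  have "K * r + H \<ge> 0" using KH \<open>r > 0\<close> by simp
  show ?thesis
  proof (intro exI[of _ "K * r + H"] conjI ballI)
    show "K * r + H \<ge> 0" by fact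
  next
    fix a b assume ab: "a \<in> M" "b \<in> M"
    then obtain n :: nat and z where z: "z 0 = a" "z n = b" "\<forall>i\<le>n. z i \<in> M"
      "\<forall>i<n. d (z i) (z (Suc i)) \<le> r"
      using path by blast
    have ends: "\<mu> a a b = a" "\<mu> a b b = b" using ab M1[of a b] M1[of b a] M2[of b b a] by auto
    have "d (\<mu> a (z 0) b) (\<mu> a (z n) b) \<le> (K * r + H) * real (card (median_interval M \<mu> a b) - 1)"
    proof (rule dist_le_step_times_card)
      show "finite (median_interval M \<mu> a b)" using finite_interval assms(1) ab by blast
      show "median_interval M \<mu> a b \<subseteq> M" using ab median_closed unfolding median_interval_def by auto
      show "\<forall>i\<le>n. \<mu> a (z i) b \<in> median_interval M \<mu> a b"
        using z unfolding median_interval_def by blast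
      show "\<forall>i<n. d (\<mu> a (z i) b) (\<mu> a (z (Suc i)) b) \<le> K * r + H"
      proof (intro allI impI)
        fix i assume "i < n"
        then have "d (\<mu> a (z i) b) (\<mu> a (z (Suc i)) b) \<le> K * d (z i) (z (Suc i)) + H"
          using lip ab z(3) by simp
        also have "\<dots> \<le> K * r + H" using z(4) \<open>i < n\<close> KH by (simp add: mult_left_mono)
        finally show "d (\<mu> a (z i) b) (\<mu> a (z (Suc i)) b) \<le> K * r + H" .
      qed
    qed fact
    then show "d a b \<le> (K * r + H) * real (card (median_interval M \<mu> a b) - 1)"
      using z ends by simp
  qed
qed

lemma dist_le_induced_metric:
  assumes bounded_geometry quasi_geodesic
  shows "\<exists>R\<ge>0. \<forall>a\<in>M. \<forall>b\<in>M. d a b \<le> R * real (induced_metric M \<mu> a b)"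
proof -
  obtain R where "R \<ge> 0" and
    R: "\<forall>a\<in>M. \<forall>b\<in>M. d a b \<le> R * real (card (median_interval M \<mu> a b) - 1)"
    using dist_le_card_interval[OF assms] by blast
  show ?thesis
  proof (intro exI[of _ R] conjI ballI \<open>R \<ge> 0\<close>)
    fix a b assume ab: "a \<in> M" "b \<in> M"
    obtain x and n :: nat where x: "x 0 = a" "x n = b" "\<forall>i\<le>n. x i \<in> M"
      "induced_metric M \<mu> a b = (\<Sum>i=1..n. (card (median_interval M \<mu> (x (i - 1)) (x i)) - 1))"
      by (rule induced_metric_attained[OF ab])
    have "d a b \<le> (\<Sum>i=1..n. d (x (i - 1)) (x i))"
      using dist_le_sum_steps[OF x(3)] x by simp
    also have "\<dots> \<le> (\<Sum>i=1..n. R * real (card (median_interval M \<mu> (x (i - 1)) (x i)) - 1))"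
      using x(3) by (intro sum_mono R[rule_format]) auto
    also have "\<dots> = R * real (induced_metric M \<mu> a b)"
      unfolding x(4) of_nat_sum by (simp add: sum_distrib_left)
    finally show "d a b \<le> R * real (induced_metric M \<mu> a b)" .
  qed
qed

lemma induced_metric_le_dist:
  assumes bounded_geometry quasi_geodesic
  shows "\<exists>N::nat. \<forall>a\<in>M. \<forall>b\<in>M. real (induced_metric M \<mu> a b) \<le> real N * (d a b + 1)"
proof -
  obtain r where "r > 0" and
    path: "\<forall>a\<in>M. \<forall>b\<in>M. \<exists>(n::nat) z. z 0 = a \<and> z n = b \<and> (\<forall>i\<le>n. z i \<in> M) \<and>
      (\<forall>i<n. d (z i) (z (Suc i)) \<le> r) \<and> real n \<le> d a b + 1"
    using quasi_geodesic_discrete_path[OF assms(2)] by blast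
  obtain N where
    N: "\<forall>a\<in>M. \<forall>b\<in>M. d a b \<le> r \<longrightarrow> card (median_interval M \<mu> a b) \<le> N"
    using card_interval_bounded[OF assms(1) less_imp_le[OF \<open>r > 0\<close>]] by blast
  show ?thesis
  proof (intro exI[of _ N] ballI)
    fix a b assume "a \<in> M" "b \<in> M"
    then obtain n :: nat and z where z: "z 0 = a" "z n = b" "\<forall>i\<le>n. z i \<in> M"
      "\<forall>i<n. d (z i) (z (Suc i)) \<le> r" "real n \<le> d a b + 1"
      using path by blast
    have "induced_metric M \<mu> a b \<le>
        (\<Sum>i=1..n. (card (median_interval M \<mu> (z (i - 1)) (z i)) - 1))"
      using induced_metric_le[OF z(3)] z by simp
    also have "\<dots> \<le> (\<Sum>i=1..n. N)"
    proof (rule sum_mono)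
      fix i assume "i \<in> {1..n}"
      then have i: "i - 1 < n" "Suc (i - 1) = i" "i \<le> n" by auto
      have "card (median_interval M \<mu> (z (i - 1)) (z i)) \<le> N"
      proof (rule N[rule_format])
        show "z (i - 1) \<in> M" "z i \<in> M" using z(3) i by simp_all
        show "d (z (i - 1)) (z i) \<le> r" using z(4)[rule_format, OF i(1)] i(2) by simp
      qed
      then show "card (median_interval M \<mu> (z (i - 1)) (z i)) - 1 \<le> N" by simp
    qed
    finally have "induced_metric M \<mu> a b \<le> N * n" by (simp add: mult.commute)
    then have "real (induced_metric M \<mu> a b) \<le> real N * real n"
      by (metis of_nat_le_iff of_nat_mult)
    also have "\<dots> \<le> real N * (d a b + 1)" using z(5) by (simp add: mult_left_mono)
    finally show "real (induced_metric M \<mu> a b) \<le> real N * (d a b + 1)" .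
  qed
qed

end

theorem theorem5p6:
  fixes M :: "'a set" and d :: "'a \<Rightarrow> 'a \<Rightarrow> real" and \<mu> :: "'a \<Rightarrow> 'a \<Rightarrow> 'a \<Rightarrow> 'a"
  assumes "coarse_median_space M d \<mu>"
    and "Metric_space.bounded_geometry M d"
    and "Metric_space.quasi_geodesic M d"
  shows "\<exists>L>0. \<exists>C>0. \<forall>a\<in>M. \<forall>b\<in>M.
    inverse L * d a b - C \<le> real (induced_metric M \<mu> a b) \<and>
    real (induced_metric M \<mu> a b) \<le> L * d a b + C"
proof -
  interpret coarse_median_space M d \<mu> by fact
  obtain R where "R \<ge> 0" and
    lower: "\<forall>a\<in>M. \<forall>b\<in>M. d a b \<le> R * real (induced_metric M \<mu> a b)"
    using dist_le_induced_metric[OF assms(2,3)] by blast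
  obtain N :: nat where
    upper: "\<forall>a\<in>M. \<forall>b\<in>M. real (induced_metric M \<mu> a b) \<le> real N * (d a b + 1)"
    using induced_metric_le_dist[OF assms(2,3)] by blast
  define L where "L = R + real N + 1"
  have L: "L > 0" "R \<le> L" "real N \<le> L" using \<open>R \<ge> 0\<close> by (simp_all add: L_def)
  have "inverse L * d a b - L \<le> real (induced_metric M \<mu> a b) \<and>
    real (induced_metric M \<mu> a b) \<le> L * d a b + L" if ab: "a \<in> M" "b \<in> M" for a b
  proof
    have "d a b \<le> L * real (induced_metric M \<mu> a b)"
      using lower[rule_format, OF ab] mult_right_mono[OF L(2), of "real (induced_metric M \<mu> a b)"] by simp
    then have "inverse L * d a b \<le> real (induced_metric M \<mu> a b)"
      using L(1) by (simp add: field_simps)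
    then show "inverse L * d a b - L \<le> real (induced_metric M \<mu> a b)"
      using L(1) by simp
    have "real N * (d a b + 1) \<le> L * (d a b + 1)"
      using L(3) by (intro mult_right_mono) auto
    then show "real (induced_metric M \<mu> a b) \<le> L * d a b + L"
      using upper[rule_format, OF ab] by (simp add: distrib_left)
  qed
  with L(1) show ?thesis by blast
qed

end
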